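(* Let $\mu_1,\mu_2,\mu_3,\mu_4$ be nonzero real numbers. Consider configurations (critical points of $V$) with $\theta_1=0$ and $\theta_2-\theta_1=\theta_3-\theta_2=\theta_4-\theta_3$, i.e. $\theta_3=2\theta_2$ and $\theta_4=3\theta_2$, where $\theta_2\in(-\pi,\pi)\setminus\{\pm2\pi/3\}$. Assume additionally that the vortices do not form a square, i.e. $\mu_1\ne\mu_3$ and $\mu_2\neq\mu_4$. Then there are six possible values of $\theta_2$ for configurations with this symmetry, corresponding to the six real roots of the polynomial $$g(r)=-1+33r^2-202r^4+146r^6-117r^8+13r^{10}.$$ For a real root $r$ of $g$, the corresponding value of $\theta_2\in(-\pi,\pi)$ is the one determined by $$\sin\theta_2=\frac{2r}{1+r^2},\qquad \cos\theta_2=\frac{r^2-1}{1+r^2},$$ and the corresponding set of circulation parameters $(\mu_1,\mu_2,\mu_3,\mu_4)$ (subject to all $\mu_i\ne0$) is $$\bigl\{\bigl(b(r)\mu_2+a(r)\mu_3,\ \mu_2,\ \mu_3,\ a(r)\mu_2+b(r)\mu_3\bigr):\ \mu_2,\mu_3\in\mathbb{R}\bigr\},$$ where $$a(r)=\tfrac{1}{272}\bigl(-753+16124r^2-11428r^4+10036r^6-1131r^8\bigr),$$ $$b(r)=\tfrac{1}{4352}\bigl(2827-168410r^2+119616r^4-107718r^6+12181r^8\bigr).$$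
   Context: The $(1+4)$-vortex problem: a dominant vortex of circulation $1$ is at the origin, and four infinitesimal vortices $v_1,v_2,v_3,v_4$ with circulation parameters $\mu_i\in\mathbb{R}\setminus\{0\}$ lie on the unit circle, $v_i$ being at the point with polar coordinates $(1,\theta_i)$. Vortices do not collide, so the angles $\theta_i$ are pairwise distinct modulo $2\pi$ (in particular $\theta_2\neq0$ here). Define $$V(\theta)=-\sum_{1\le i<j\le 4}\mu_i\mu_j\left[\cos(\theta_i-\theta_j)+\tfrac12\log\bigl(2-2\cos(\theta_i-\theta_j)\bigr)\right].$$ A configuration of the $(1+4)$-vortex problem with circulation parameters $(\mu_1,\dots,\mu_4)$ means a critical point $\theta=(\theta_1,\dots,\theta_4)$ of $V$. *)

theory Defs
  imports
    "HOL-Analysis.Analysis"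
    "HOL-Library.Real_Mod"
    "HOL-Computational_Algebra.Polynomial"
begin

text \<open>
  The indices \<open>1, 2, 3, 4\<close> are the elements of the four-element type \<open>4\<close>, in which \<open>4 = 0\<close>.
  The order \<open><\<close> of that type therefore puts \<open>4\<close> first.  This does not affect \<open>V\<close>: the
  summand is symmetric in \<open>i\<close> and \<open>j\<close>, and \<open>i < j\<close> selects each unordered pair once.
\<close>

definition V :: "real^4 \<Rightarrow> real^4 \<Rightarrow> real" where
  "V \<mu> \<theta> = - (\<Sum>(i, j) \<in> {(i, j). i < j}. \<mu> $ i * \<mu> $ j *
      (cos (\<theta> $ i - \<theta> $ j) + 1 / 2 * ln (2 - 2 * cos (\<theta> $ i - \<theta> $ j))))"

text \<open>
  \<open>V\<close> has a logarithmic singularity at a collision, where the totalised \<open>ln 0 = 0\<close> has no meaning,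
  so the absence of collisions is required explicitly.
\<close>

definition configuration :: "real^4 \<Rightarrow> real^4 \<Rightarrow> bool" where
  "configuration \<mu> \<theta> \<longleftrightarrow>
     (\<forall>i j. i \<noteq> j \<longrightarrow> \<not> [\<theta> $ i = \<theta> $ j] (rmod (2 * pi))) \<and>
     (V \<mu> has_derivative (\<lambda>_. 0)) (at \<theta>)"

definition equispaced :: "real^4 \<Rightarrow> bool" where
  "equispaced \<theta> \<longleftrightarrow>
     \<theta> $ 1 = 0 \<and> \<theta> $ 2 - \<theta> $ 1 = \<theta> $ 3 - \<theta> $ 2 \<and> \<theta> $ 3 - \<theta> $ 2 = \<theta> $ 4 - \<theta> $ 3 \<and>
     \<theta> $ 2 \<in> {-pi<..<pi} - {2 * pi / 3, - (2 * pi / 3)}"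

definition nonzero_params :: "real^4 \<Rightarrow> bool" where
  "nonzero_params \<mu> \<longleftrightarrow> (\<forall>i. \<mu> $ i \<noteq> 0)"

text \<open>
  For nonzero parameters, an equispaced configuration is a square (\<open>\<theta> $ 2 = \<plusminus> pi / 2\<close>) exactly
  when one of these two inequalities fails, and then both fail.
\<close>

definition nonsquare_params :: "real^4 \<Rightarrow> bool" where
  "nonsquare_params \<mu> \<longleftrightarrow> \<mu> $ 1 \<noteq> \<mu> $ 3 \<and> \<mu> $ 2 \<noteq> \<mu> $ 4"

definition params_at :: "real \<Rightarrow> (real^4) set" where
  "params_at t = {\<mu>. nonzero_params \<mu> \<and> nonsquare_params \<mu> \<and>
     (\<exists>\<theta>. equispaced \<theta> \<and> \<theta> $ 2 = t \<and> configuration \<mu> \<theta>)}"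

definition possible_angles :: "real set" where
  "possible_angles = {t. params_at t \<noteq> {}}"

definition g :: "real poly" where
  "g = [:-1, 0, 33, 0, -202, 0, 146, 0, -117, 0, 13:]"

definition a :: "real \<Rightarrow> real" where
  "a r = 1 / 272 * (-753 + 16124 * r^2 - 11428 * r^4 + 10036 * r^6 - 1131 * r^8)"

definition b :: "real \<Rightarrow> real" where
  "b r = 1 / 4352 * (2827 - 168410 * r^2 + 119616 * r^4 - 107718 * r^6 + 12181 * r^8)"

definition angle_of :: "real \<Rightarrow> real \<Rightarrow> bool" where
  "angle_of r t \<longleftrightarrow> t \<in> {-pi<..<pi} \<and>
     sin t = 2 * r / (1 + r^2) \<and> cos t = (r^2 - 1) / (1 + r^2)"

definition param_family :: "real \<Rightarrow> (real^4) set" where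
  "param_family r =
     {vector [b r * \<mu>2 + a r * \<mu>3, \<mu>2, \<mu>3, a r * \<mu>2 + b r * \<mu>3] | \<mu>2 \<mu>3. True}"

end

theory Submission
  imports Defs
begin

text \<open>
  Write \<open>U(x) = cos x + ln (2 - 2 cos x) / 2\<close> for the potential of a pair and \<open>D = U'\<close>, an odd function.
  Since the \<open>\<mu>\<close> are nonzero, \<open>\<theta>\<close> is a critical point of \<open>V\<close> iff
  \<open>\<Sum>j. \<mu> j * D (\<theta> i - \<theta> j) = 0\<close> for every \<open>i\<close> (\<open>configuration_iff\<close>).  At the angles
  \<open>0, t, 2 t, 3 t\<close> this is a linear system in \<open>\<mu>\<close> whose matrix is antisymmetric, with the
  entries \<open>A = D t\<close>, \<open>B = D (2 t)\<close>, \<open>C = D (3 t)\<close> above the diagonal, up to a common sign.  An antisymmetric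
  \<open>4 \<times> 4\<close> system has a nonzero solution iff its Pfaffian, here \<open>A\<^sup>2 - B\<^sup>2 + A C\<close>, vanishes.  If moreover
  \<open>C \<noteq> 0\<close>, the solutions form the plane
  \<open>\<mu>1 = -(B/C) \<mu>2 - (A/C) \<mu>3\<close>, \<open>\<mu>4 = -(A/C) \<mu>2 - (B/C) \<mu>3\<close>.

  In the parameter \<open>r = cot (t / 2)\<close> the numbers \<open>A, B, C\<close> are rational functions of \<open>r\<close>, and the Pfaffian
  is \<open>(r\<^sup>2 - 1) (r\<^sup>2 + 1) g(r)\<close> over a nonvanishing denominator (\<open>force_pfaffian\<close>).  The factor \<open>r\<^sup>2 - 1\<close>
  belongs to the square \<open>t = \<plusminus> pi / 2\<close>.  A solution is nonsquare iff \<open>B \<noteq> 0\<close> (\<open>nonsquare_iff\<close>), and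
  \<open>B\<close> has the factor \<open>r\<^sup>2 - 1\<close>, so \<open>g(r) = 0\<close> is what remains.  At a root of \<open>g\<close> none of \<open>A\<close>, \<open>B\<close>, \<open>C\<close>
  vanishes, and the rational functions \<open>-A/C\<close> and \<open>-B/C\<close> agree there with the polynomials
  \<open>a\<close> and \<open>b\<close>, because the cross-multiplied differences are multiples of \<open>g\<close>.

  The polynomial \<open>g\<close> is a quintic \<open>G\<close> in \<open>r\<^sup>2\<close>.  Sign changes give three positive roots of \<open>G\<close>; by
  Rolle's theorem there are no more, as \<open>G''\<close> has only one real root.  Hence \<open>g\<close> has the six roots
  \<open>\<plusminus> sqrt x\<close>, where \<open>x\<close> runs through the roots of \<open>G\<close>.
\<close>

section \<open>Critical points as solutions of a linear system\<close>

lemma vector_4 [simp]: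
  "(vector [x, y, z, w] :: 'a::zero^4) $ 1 = x"
  "(vector [x, y, z, w] :: 'a::zero^4) $ 2 = y"
  "(vector [x, y, z, w] :: 'a::zero^4) $ 3 = z"
  "(vector [x, y, z, w] :: 'a::zero^4) $ 4 = w"
  unfolding vector_def by simp_all

lemma rcong_2pi_iff_cos: "[x = y] (rmod (2 * pi)) \<longleftrightarrow> cos (x - y) = 1"
proof -
  have "[x = y] (rmod (2 * pi)) \<longleftrightarrow> [y = x] (rmod (2 * pi))"
    by (rule rcong_sym_iff)
  also have "\<dots> \<longleftrightarrow> (\<exists>n. x - y = of_int n * 2 * pi)"
    unfolding rcong_altdef by (simp add: algebra_simps)
  finally show ?thesis
    by (simp add: cos_one_2pi_int)
qed

text \<open>
  The derivative of the pair potential.  At \<open>0\<close> the second summand is \<open>0 / 0 = 0\<close>, so that the diagonal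
  terms drop out of sums over all \<open>j\<close>.
\<close>

definition pair_force :: "real \<Rightarrow> real" where
  "pair_force x = - sin x + sin x / (2 * (1 - cos x))"

lemma pair_force_minus: "pair_force (- x) = - pair_force x"
  by (simp add: pair_force_def)

lemma pair_force_0 [simp]: "pair_force 0 = 0"
  by (simp add: pair_force_def)

lemma pair_potential_has_derivative:
  assumes "cos x \<noteq> 1"
  shows "((\<lambda>x. cos x + 1 / 2 * ln (2 - 2 * cos x)) has_real_derivative pair_force x) (at x)"
proof -
  have "cos x < 1"
    using assms cos_le_one[of x] by linarith
  then show ?thesis
    unfolding pair_force_def
    by (auto intro!: derivative_eq_intros simp: field_simps)
qed

text \<open>
  Each unordered pair enters the differential of \<open>V\<close> once.  Antisymmetry turns
  \<open>- w i j * h j\<close> into \<open>w j i * h j\<close>, so the coefficient of \<open>h i\<close> becomes the \<open>i\<close>-th row sum of \<open>w\<close>.\<close>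

lemma sum_antisymmetric_pairs:
  fixes w :: "'a::{finite, linorder} \<Rightarrow> 'a \<Rightarrow> real"
  assumes antisym: "\<And>i j. w i j = - w j i"
  shows "(\<Sum>(i, j)\<in>{(i, j). i < j}. w i j * (h i - h j)) = (\<Sum>i\<in>UNIV. h i * (\<Sum>j\<in>UNIV. w i j))"
proof -
  define L :: "('a \<times> 'a) set" where "L = {(i, j). i < j}"
  have diag: "w i i = 0" for i
    using antisym[of i i] by simp
  have swap: "(\<Sum>(i, j)\<in>prod.swap ` L. h i * w i j) = (\<Sum>(i, j)\<in>L. h j * w j i)"
    by (subst sum.reindex) (auto simp: case_prod_unfold)
  have "(\<Sum>i\<in>UNIV. h i * (\<Sum>j\<in>UNIV. w i j)) = (\<Sum>(i, j)\<in>UNIV. h i * w i j)"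
    by (simp add: sum_distrib_left sum.cartesian_product)
  also have "\<dots> = (\<Sum>(i, j)\<in>L \<union> prod.swap ` L. h i * w i j)"
  proof (rule sum.mono_neutral_right)
    have "(i, j) \<in> L \<union> prod.swap ` L \<or> i = j" for i j
    proof (cases i j rule: linorder_cases)
      case greater
      then have "prod.swap (j, i) \<in> prod.swap ` L"
        by (intro imageI) (simp add: L_def)
      then show ?thesis
        by simp
    qed (simp_all add: L_def)
    then have "fst p = snd p" if "p \<notin> L \<union> prod.swap ` L" for p
      using that by (metis prod.collapse)
    then show "\<forall>p\<in>UNIV - (L \<union> prod.swap ` L). (case p of (i, j) \<Rightarrow> h i * w i j) = 0"
      unfolding case_prod_unfold by (simp add: diag)
  qed (rule finite, rule subset_UNIV)
  also have "\<dots> = (\<Sum>(i, j)\<in>L. h i * w i j) + (\<Sum>(i, j)\<in>prod.swap ` L. h i * w i j)"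
  proof (rule sum.union_disjoint)
    show "L \<inter> prod.swap ` L = {}"
      by (auto simp: L_def)
  qed (rule finite)+
  also have "\<dots> = (\<Sum>(i, j)\<in>L. h i * w i j + h j * w j i)"
    unfolding swap by (simp add: sum.distrib case_prod_unfold)
  also have "\<dots> = (\<Sum>(i, j)\<in>L. w i j * (h i - h j))"
  proof (rule sum.cong, goal_cases)
    case (2 p)
    show ?case
      unfolding case_prod_unfold antisym[of "snd p" "fst p"] by (simp add: algebra_simps)
  qed simp
  finally show ?thesis
    by (simp add: L_def)
qed

lemma V_has_derivative:
  assumes "\<And>i j. i \<noteq> j \<Longrightarrow> cos (\<theta> $ i - \<theta> $ j) \<noteq> 1"
  shows "(V \<mu> has_derivative
    (\<lambda>h. - (\<Sum>i\<in>UNIV. h $ i * (\<Sum>j\<in>UNIV. \<mu> $ i * \<mu> $ j * pair_force (\<theta> $ i - \<theta> $ j))))) (at \<theta>)"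
proof -
  let ?U = "\<lambda>x. cos x + 1 / 2 * ln (2 - 2 * cos x)"
  let ?w = "\<lambda>i j. \<mu> $ i * \<mu> $ j * pair_force (\<theta> $ i - \<theta> $ j)"
  have pair: "((\<lambda>\<theta>. \<mu> $ i * \<mu> $ j * ?U (\<theta> $ i - \<theta> $ j)) has_derivative
      (\<lambda>h. ?w i j * (h $ i - h $ j))) (at \<theta>)" if "i < j" for i j
  proof -
    have "((\<lambda>\<theta> :: real^4. \<theta> $ i - \<theta> $ j) has_derivative (\<lambda>h. h $ i - h $ j)) (at \<theta>)"
      by (intro has_derivative_diff bounded_linear_imp_has_derivative bounded_linear_vec_nth)
    moreover have "(?U has_real_derivative pair_force (\<theta> $ i - \<theta> $ j)) (at (\<theta> $ i - \<theta> $ j))"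
      using assms that by (intro pair_potential_has_derivative) auto
    ultimately have "((\<lambda>\<theta>. ?U (\<theta> $ i - \<theta> $ j)) has_derivative
        (\<lambda>h. (h $ i - h $ j) * pair_force (\<theta> $ i - \<theta> $ j))) (at \<theta>)"
      by (rule DERIV_compose_FDERIV[rotated])
    from has_derivative_mult_right[OF this, of "\<mu> $ i * \<mu> $ j"] show ?thesis
      by (simp add: mult_ac)
  qed
  have "(V \<mu> has_derivative (\<lambda>h. - (\<Sum>(i, j)\<in>{(i, j). i < j}. ?w i j * (h $ i - h $ j)))) (at \<theta>)"
    unfolding V_def case_prod_unfold
    by (intro has_derivative_minus has_derivative_sum) (use pair in auto)
  moreover have "?w i j = - ?w j i" for i j
    using pair_force_minus[of "\<theta> $ i - \<theta> $ j"] by simp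
  ultimately show ?thesis
    by (subst (asm) sum_antisymmetric_pairs)
qed

text \<open>
  The \<open>i\<close>-th partial derivative of \<open>V\<close> is \<open>- \<mu> i\<close> times the \<open>i\<close>-th sum, and \<open>\<mu> i\<close> can be cancelled.
\<close>

lemma configuration_iff:
  assumes "nonzero_params \<mu>"
  shows "configuration \<mu> \<theta> \<longleftrightarrow>
    (\<forall>i j. i \<noteq> j \<longrightarrow> cos (\<theta> $ i - \<theta> $ j) \<noteq> 1) \<and>
    (\<forall>i. (\<Sum>j\<in>UNIV. \<mu> $ j * pair_force (\<theta> $ i - \<theta> $ j)) = 0)"
proof -
  let ?E = "\<lambda>i. \<Sum>j\<in>UNIV. \<mu> $ j * pair_force (\<theta> $ i - \<theta> $ j)"
  let ?V' = "\<lambda>h :: real^4. - (\<Sum>i\<in>UNIV. h $ i * (\<mu> $ i * ?E i))"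
  have "(V \<mu> has_derivative (\<lambda>_. 0)) (at \<theta>) \<longleftrightarrow> (\<forall>i. ?E i = 0)"
    if nc: "\<And>i j. i \<noteq> j \<Longrightarrow> cos (\<theta> $ i - \<theta> $ j) \<noteq> 1"
  proof -
    have V': "(V \<mu> has_derivative ?V') (at \<theta>)"
      using V_has_derivative[of \<theta> \<mu>, OF nc] by (simp add: sum_distrib_left mult_ac)
    have "?V' = (\<lambda>_. 0) \<longleftrightarrow> (\<forall>i. ?E i = 0)"
    proof
      assume *: "?V' = (\<lambda>_. 0)"
      show "\<forall>i. ?E i = 0"
      proof
        fix i
        have "\<mu> $ i * ?E i = - ?V' (axis i 1)"
          by (simp add: axis_def if_distrib if_distribR sum.delta cong: if_cong)
        also have "\<dots> = 0"
          using fun_cong[OF *, of "axis i 1"] by simp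
        finally show "?E i = 0"
          using assms by (simp add: nonzero_params_def)
      qed
    qed auto
    moreover have "(V \<mu> has_derivative (\<lambda>_. 0)) (at \<theta>) \<longleftrightarrow> ?V' = (\<lambda>_. 0)"
    proof
      assume "(V \<mu> has_derivative (\<lambda>_. 0)) (at \<theta>)"
      with V' show "?V' = (\<lambda>_. 0)"
        by (rule has_derivative_unique)
    next
      assume "?V' = (\<lambda>_. 0)"
      with V' show "(V \<mu> has_derivative (\<lambda>_. 0)) (at \<theta>)"
        by (rule back_subst)
    qed
    ultimately show ?thesis
      by (rule trans[rotated])
  qed
  then show ?thesis
    unfolding configuration_def rcong_2pi_iff_cos by blast
qed

section \<open>The real roots of \<open>g\<close>\<close>

text \<open>
  Rolle's theorem yields a root of the derivative between each root \<open>x\<close> of \<open>p\<close> other than the largest and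
  the next root \<open>nxt x\<close>; these roots of the derivative are distinct because the intervals do not overlap.
\<close>

lemma card_roots_le_Suc_card_roots_pderiv:
  fixes p :: "real poly"
  assumes "pderiv p \<noteq> 0"
  shows "card {x. poly p x = 0} \<le> Suc (card {x. poly (pderiv p) x = 0})"
proof -
  define S where "S = {x. poly p x = 0}"
  have fin: "finite S"
    unfolding S_def using assms by (intro poly_roots_finite) auto
  define nxt where "nxt x = Min {y \<in> S. x < y}" for x
  have nxt: "nxt x \<in> S" "x < nxt x" "\<And>y. y \<in> S \<Longrightarrow> x < y \<Longrightarrow> nxt x \<le> y" if "x \<in> S - {Max S}" for x
  proof -
    have "x < Max S" "Max S \<in> S"
      using that Max_ge[OF fin, of x] Max_in[OF fin] by (auto simp: less_le)
    then have "{y \<in> S. x < y} \<noteq> {}" "finite {y \<in> S. x < y}"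
      using fin by auto
    from Min_in[OF this(2,1)] show "nxt x \<in> S" "x < nxt x"
      by (auto simp: nxt_def)
    show "nxt x \<le> y" if "y \<in> S" "x < y" for y
      unfolding nxt_def using that fin by (intro Min_le) auto
  qed
  have "\<forall>x \<in> S - {Max S}. \<exists>z. x < z \<and> z < nxt x \<and> poly (pderiv p) z = 0"
  proof
    fix x assume x: "x \<in> S - {Max S}"
    obtain z where "x < z" "z < nxt x" "poly p (nxt x) - poly p x = (nxt x - x) * poly (pderiv p) z"
      using poly_MVT[OF nxt(2)[OF x], of p] by blast
    moreover have "poly p (nxt x) = 0" "poly p x = 0"
      using x nxt(1)[OF x] by (auto simp: S_def)
    ultimately show "\<exists>z. x < z \<and> z < nxt x \<and> poly (pderiv p) z = 0"
      by auto
  qed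
  from bchoice[OF this] obtain f
    where f: "\<And>x. x \<in> S - {Max S} \<Longrightarrow> x < f x \<and> f x < nxt x \<and> poly (pderiv p) (f x) = 0"
    by blast
  have "f x < f y" if "x \<in> S - {Max S}" "y \<in> S - {Max S}" "x < y" for x y
  proof -
    have "nxt x \<le> y"
      using nxt(3)[OF that(1), of y] that(2,3) by blast
    with f[OF that(1)] f[OF that(2)] show ?thesis
      by linarith
  qed
  then have "strict_mono_on (S - {Max S}) f"
    by (simp add: strict_mono_on_def)
  then have "inj_on f (S - {Max S})"
    by (rule strict_mono_on_imp_inj_on)
  moreover have "f ` (S - {Max S}) \<subseteq> {x. poly (pderiv p) x = 0}"
    using f by blast
  moreover have "finite {x. poly (pderiv p) x = 0}"
    using assms by (rule poly_roots_finite)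
  ultimately have "card (S - {Max S}) \<le> card {x. poly (pderiv p) x = 0}"
    by (rule card_inj_on_le)
  moreover have "card S - 1 \<le> card (S - {Max S})"
    by (simp add: card_Diff_singleton_if)
  ultimately show ?thesis
    unfolding S_def by linarith
qed

text \<open>The polynomial \<open>g\<close> in the variable \<open>x = r\<^sup>2\<close>.\<close>

definition quintic :: "real poly" where
  "quintic = [:-1, 33, -202, 146, -117, 13:]"

lemma poly_quintic:
  "poly quintic x = -1 + 33 * x - 202 * x^2 + 146 * x^3 - 117 * x^4 + 13 * x^5"
  by (simp add: quintic_def algebra_simps power_numeral_reduce)

lemma poly_g_eq: "poly g r = poly quintic (r\<^sup>2)"
  by (simp add: g_def quintic_def algebra_simps power2_eq_square)

text \<open>The coefficients alternate in sign.\<close>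

lemma quintic_root_pos: "x > 0" if "poly quintic x = 0"
proof (rule ccontr)
  assume "\<not> x > 0"
  then have "33 * x \<le> 0" "- 202 * x^2 \<le> 0" "146 * x^3 \<le> 0" "- 117 * x^4 \<le> 0" "13 * x^5 \<le> 0"
    by (auto simp: mult_le_0_iff power_le_zero_eq)
  with that show False
    unfolding poly_quintic by linarith
qed

lemma quintic_second_derivative:
  "poly (pderiv (pderiv quintic)) x = 4 * (65 * x^3 - 351 * x^2 + 219 * x - 101)"
  by (simp add: quintic_def pderiv_pCons algebra_simps power_numeral_reduce)

text \<open>
  The cubic \<open>c(x) = 65 x\<^sup>3 - 351 x\<^sup>2 + 219 x - 101\<close> is negative for \<open>x \<le> 4\<close> and strictly increasing beyond.
\<close>

lemma quintic_inflection_unique: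
  assumes "poly (pderiv (pderiv quintic)) u = 0" "poly (pderiv (pderiv quintic)) v = 0"
  shows "u = v"
proof (rule ccontr)
  assume "u \<noteq> v"
  have gt4: "x > 4" if "65 * x^3 - 351 * x^2 + 219 * x - 101 = 0" for x :: real
  proof (rule ccontr)
    assume "\<not> x > 4"
    show False
    proof (cases "x \<le> 2")
      \<comment> \<open>Replacing \<open>65 x\<^sup>3\<close> by \<open>130 x\<^sup>2\<close> leaves a quadratic with negative discriminant.\<close>
      case True
      have "65 * x^3 - 351 * x^2 + 219 * x - 101
          = x^2 * (65 * (x - 2)) - 221 * (x - 219/442)^2 - (101 - 219^2/884)"
        by (simp add: field_simps power_numeral_reduce)
      moreover have "x^2 * (65 * (x - 2)) \<le> 0"
        using True by (intro mult_nonneg_nonpos) auto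
      ultimately show False
        using that zero_le_power2[of "x - 219/442"] by simp
    next
      \<comment> \<open>Here \<open>65 x\<^sup>3 \<le> 260 x\<^sup>2\<close>, and the remaining quadratic is negative for \<open>x \<ge> 2\<close>.\<close>
      case False
      have "65 * x^3 - 351 * x^2 + 219 * x - 101
          = x^2 * (65 * (x - 4)) - (x - 2) * (91 * x - 37) - 27"
        by (simp add: field_simps power_numeral_reduce)
      moreover have "x^2 * (65 * (x - 4)) \<le> 0"
        using \<open>\<not> x > 4\<close> by (intro mult_nonneg_nonpos) auto
      moreover have "(x - 2) * (91 * x - 37) \<ge> 0"
        using False by (intro mult_nonneg_nonneg) auto
      ultimately show False
        using that by simp
    qed
  qed
  have roots: "65 * u^3 - 351 * u^2 + 219 * u - 101 = 0" "65 * v^3 - 351 * v^2 + 219 * v - 101 = 0"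
    using assms by (simp_all add: quintic_second_derivative)
  \<comment> \<open>The divided difference of the cubic at \<open>u\<close> and \<open>v\<close> is positive for \<open>u, v > 4\<close>.\<close>
  then have "(u - v) * (65 * (u^2 + u * v + v^2) - 351 * (u + v) + 219) = 0"
    by algebra
  then have "65 * (u^2 + u * v + v^2) - 351 * (u + v) + 219 = 0"
    using \<open>u \<noteq> v\<close> by simp
  moreover have "(u - 4) * (u - 4) > 0" "(u - 4) * (v - 4) > 0" "(v - 4) * (v - 4) > 0"
    using gt4 roots by (auto intro!: mult_pos_pos)
  ultimately show False
    using gt4[OF roots(1)] gt4[OF roots(2)] by (simp add: algebra_simps power2_eq_square)
qed

lemma card_roots_quintic: "card {x. poly quintic x = 0} = 3"
proof (rule antisym)
  let ?R = "{x. poly quintic x = 0}"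
  have fin: "finite ?R"
    by (intro poly_roots_finite) (simp add: quintic_def)
  have "card {x. poly (pderiv (pderiv quintic)) x = 0} \<le> 1"
  proof -
    have "finite {x. poly (pderiv (pderiv quintic)) x = 0}"
      by (rule poly_roots_finite) (simp add: quintic_def pderiv_pCons)
    then show ?thesis
      using quintic_inflection_unique by (simp add: card_le_Suc0_iff_eq)
  qed
  moreover have "card {x. poly (pderiv quintic) x = 0} \<le> Suc (card {x. poly (pderiv (pderiv quintic)) x = 0})"
    by (rule card_roots_le_Suc_card_roots_pderiv) (simp add: quintic_def pderiv_pCons)
  moreover have "card ?R \<le> Suc (card {x. poly (pderiv quintic) x = 0})"
    by (rule card_roots_le_Suc_card_roots_pderiv) (simp add: quintic_def pderiv_pCons)
  ultimately show "card ?R \<le> 3"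
    by linarith
  have "\<exists>u>0. u < 1/10 \<and> poly quintic u = 0"
    by (rule poly_IVT_pos) (simp_all add: quintic_def)
  then obtain u where u: "u < 1/10" "poly quintic u = 0"
    by blast
  have "\<exists>v>1/10. v < 1 \<and> poly quintic v = 0"
    by (rule poly_IVT_neg) (simp_all add: quintic_def)
  then obtain v where v: "1/10 < v" "v < 1" "poly quintic v = 0"
    by blast
  have "\<exists>w>1. w < 8 \<and> poly quintic w = 0"
    by (rule poly_IVT_pos) (simp_all add: quintic_def)
  then obtain w where w: "1 < w" "poly quintic w = 0"
    by blast
  have "card {u, v, w} = 3"
    using u v w by simp
  moreover have "card {u, v, w} \<le> card ?R"
    using u v w fin by (intro card_mono) auto
  ultimately show "3 \<le> card ?R"
    by simp
qed

lemma card_roots_g: "card {r. poly g r = 0} = 6"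
proof -
  define X where "X = {x. poly quintic x = 0}"
  have pos: "x > 0" if "x \<in> X" for x
    using that quintic_root_pos by (simp add: X_def)
  have cX: "card X = 3"
    unfolding X_def by (rule card_roots_quintic)
  then have "finite X"
    by (intro card_ge_0_finite) simp
  have "{r. poly g r = 0} = sqrt ` X \<union> (\<lambda>x. - sqrt x) ` X"
  proof (intro equalityI subsetI)
    fix r assume "r \<in> {r. poly g r = 0}"
    then have "r\<^sup>2 \<in> X"
      by (simp add: poly_g_eq X_def)
    moreover have "r = sqrt (r\<^sup>2) \<or> r = - sqrt (r\<^sup>2)"
      by (simp add: abs_if)
    ultimately show "r \<in> sqrt ` X \<union> (\<lambda>x. - sqrt x) ` X"
      by blast
  next
    fix r assume "r \<in> sqrt ` X \<union> (\<lambda>x. - sqrt x) ` X"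
    then obtain x where "x \<in> X" "r = sqrt x \<or> r = - sqrt x"
      by blast
    with pos[of x] show "r \<in> {r. poly g r = 0}"
      by (auto simp: poly_g_eq X_def)
  qed
  moreover have "sqrt ` X \<inter> (\<lambda>x. - sqrt x) ` X = {}"
  proof -
    have "sqrt x \<noteq> - sqrt y" if "x \<in> X" "y \<in> X" for x y
      using pos[OF that(1)] pos[OF that(2)] by (smt (verit) real_sqrt_gt_zero)
    then show ?thesis
      by blast
  qed
  moreover have "card (sqrt ` X) = 3" "card ((\<lambda>x. - sqrt x) ` X) = 3"
    using cX by (simp_all add: card_image inj_on_def)
  ultimately show ?thesis
    using \<open>finite X\<close> by (simp add: card_Un_disjoint)
qed

section \<open>The forces in terms of the half-angle cotangent\<close>

text \<open>
  The forces at the angles \<open>t\<close>, \<open>2 t\<close>, \<open>3 t\<close> as rational functions of \<open>r = cot (t / 2)\<close>.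
  The relation \<open>angle_of r t\<close> expresses \<open>r = cot (t / 2)\<close> for \<open>- pi < t < pi\<close>.
\<close>

definition force1 :: "real \<Rightarrow> real" where
  "force1 r = r * (r\<^sup>2 - 3) / (2 * (1 + r\<^sup>2))"

definition force2 :: "real \<Rightarrow> real" where
  "force2 r = (r\<^sup>2 - 1) * (r^4 - 14 * r\<^sup>2 + 1) / (4 * r * (1 + r\<^sup>2)\<^sup>2)"

definition force3 :: "real \<Rightarrow> real" where
  "force3 r = r * (r\<^sup>2 - 3) * (r^6 - 33 * r^4 + 27 * r\<^sup>2 - 3) / (2 * (3 * r\<^sup>2 - 1) * (1 + r\<^sup>2)^3)"

lemma one_plus_square_pos: "1 + r\<^sup>2 > (0::real)"
  by (simp add: add_pos_nonneg)

text \<open>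
  The differences \<open>1 - cos (k t)\<close> are stated because they decide about collisions and are the denominators
  in \<open>pair_force\<close>.
\<close>

lemma angle_of_multiple_angles:
  assumes "angle_of r t"
  shows "1 - cos t = 2 / (1 + r\<^sup>2)" "sin t = 2 * r / (1 + r\<^sup>2)"
    "1 - cos (2 * t) = 8 * r\<^sup>2 / (1 + r\<^sup>2)\<^sup>2"
    "sin (2 * t) = 4 * r * (r\<^sup>2 - 1) / (1 + r\<^sup>2)\<^sup>2"
    "1 - cos (3 * t) = 2 * (3 * r\<^sup>2 - 1)\<^sup>2 / (1 + r\<^sup>2)^3"
    "sin (3 * t) = 2 * r * (r\<^sup>2 - 3) * (3 * r\<^sup>2 - 1) / (1 + r\<^sup>2)^3"
proof -
  define u where "u = 1 + r\<^sup>2"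
  have u: "u \<noteq> 0" and r2: "r\<^sup>2 = u - 1"
    using one_plus_square_pos[of r] by (simp_all add: u_def)
  have s: "sin t = 2 * r / u" and c: "cos t = (u - 2) / u"
    using assms by (simp_all add: angle_of_def u_def)
  have ss: "sin t * sin t = 4 * (u - 1) / u\<^sup>2"
    by (simp add: s r2[symmetric] power2_eq_square)
  have three: "3 * t = 2 * t + t"
    by simp
  have s2: "sin (2 * t) = 4 * r * (u - 2) / u\<^sup>2"
    by (simp add: sin_double s c power2_eq_square)
  have c2: "cos (2 * t) = 1 - 8 * (u - 1) / u\<^sup>2"
    by (simp add: cos_double_sin power2_eq_square ss)
  have s2s: "sin (2 * t) * sin t = 8 * (u - 1) * (u - 2) / u^3"
    using r2 by (simp add: s2 s power2_eq_square power3_eq_cube)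
  have c3: "cos (3 * t) = (1 - 8 * (u - 1) / u\<^sup>2) * ((u - 2) / u) - 8 * (u - 1) * (u - 2) / u^3"
    unfolding three cos_add s2s unfolding c2 c ..
  have s3: "sin (3 * t) = 4 * r * (u - 2) / u\<^sup>2 * ((u - 2) / u) + (1 - 8 * (u - 1) / u\<^sup>2) * (2 * r / u)"
    unfolding three sin_add s2 c2 c s ..
  show "1 - cos t = 2 / (1 + r\<^sup>2)" "sin t = 2 * r / (1 + r\<^sup>2)"
    using u by (simp_all add: s c u_def[symmetric] field_simps)
  show "1 - cos (2 * t) = 8 * r\<^sup>2 / (1 + r\<^sup>2)\<^sup>2"
    "sin (2 * t) = 4 * r * (r\<^sup>2 - 1) / (1 + r\<^sup>2)\<^sup>2"
    by (simp_all add: s2 c2 u_def[symmetric] r2)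
  have "1 - cos (3 * t) = 2 * (3 * (u - 1) - 1)\<^sup>2 / u^3"
    unfolding c3 using u by (simp add: field_simps power_numeral_reduce)
  then show "1 - cos (3 * t) = 2 * (3 * r\<^sup>2 - 1)\<^sup>2 / (1 + r\<^sup>2)^3"
    by (simp add: u_def)
  have "sin (3 * t) = 2 * r * (u - 1 - 3) * (3 * (u - 1) - 1) / u^3"
    unfolding s3 using u by (simp add: field_simps power_numeral_reduce)
  then show "sin (3 * t) = 2 * r * (r\<^sup>2 - 3) * (3 * r\<^sup>2 - 1) / (1 + r\<^sup>2)^3"
    by (simp add: u_def)
qed

lemma no_collision_iff:
  assumes "angle_of r t"
  shows "cos t \<noteq> 1 \<and> cos (2 * t) \<noteq> 1 \<and> cos (3 * t) \<noteq> 1 \<longleftrightarrow> r \<noteq> 0 \<and> 3 * r\<^sup>2 \<noteq> 1"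
proof -
  have "cos t \<noteq> 1" "cos (2 * t) = 1 \<longleftrightarrow> r = 0" "cos (3 * t) = 1 \<longleftrightarrow> 3 * r\<^sup>2 = 1"
    using angle_of_multiple_angles(1,3,5)[OF assms] one_plus_square_pos[of r]
    by (auto simp: divide_eq_0_iff)
  then show ?thesis
    by blast
qed

text \<open>
  Each force is \<open>- sin x + cot (x / 2) / 2\<close>, where \<open>cot (x / 2)\<close> is \<open>r\<close>, \<open>(r\<^sup>2 - 1) / (2 r)\<close> and
  \<open>r (r\<^sup>2 - 3) / (3 r\<^sup>2 - 1)\<close> for \<open>x = t, 2 t, 3 t\<close>; this uses that none of these angles is a multiple of \<open>2 pi\<close>.
\<close>

lemma pair_force_angle_of:
  assumes "angle_of r t" "r \<noteq> 0" "3 * r\<^sup>2 \<noteq> 1"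
  shows "pair_force t = force1 r" "pair_force (2 * t) = force2 r" "pair_force (3 * t) = force3 r"
proof -
  define u where "u = 1 + r\<^sup>2"
  have u: "u \<noteq> 0"
    using one_plus_square_pos[of r] by (simp add: u_def)
  define v where "v = 3 * r\<^sup>2 - 1"
  have v: "v \<noteq> 0"
    using assms(3) by (simp add: v_def)
  note trig = angle_of_multiple_angles[OF assms(1), folded u_def, folded v_def]
  have "2 * r / u / (2 * (2 / u)) = r / 2"
    using u by (simp add: field_simps)
  then have "pair_force t = - (2 * r / u) + r / 2"
    unfolding pair_force_def trig by simp
  also have "\<dots> = r * (u - 4) / (2 * u)"
    using u by (simp add: field_simps)
  also have "u - 4 = r\<^sup>2 - 3"
    by (simp add: u_def)
  finally show "pair_force t = force1 r"
    by (simp only: force1_def u_def)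
  have "4 * r * (r\<^sup>2 - 1) / u\<^sup>2 / (2 * (8 * r\<^sup>2 / u\<^sup>2)) = (r\<^sup>2 - 1) / (4 * r)"
    using u assms(2) by (simp add: field_simps power2_eq_square)
  then have "pair_force (2 * t) = - (4 * r * (r\<^sup>2 - 1) / u\<^sup>2) + (r\<^sup>2 - 1) / (4 * r)"
    unfolding pair_force_def trig by simp
  also have "\<dots> = (r\<^sup>2 - 1) * (u\<^sup>2 - 16 * r\<^sup>2) / (4 * r * u\<^sup>2)"
    using u assms(2) by (simp add: field_simps power2_eq_square)
  also have "u\<^sup>2 - 16 * r\<^sup>2 = r^4 - 14 * r\<^sup>2 + 1"
    by (simp add: u_def power2_eq_square power4_eq_xxxx algebra_simps)
  finally show "pair_force (2 * t) = force2 r"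
    by (simp add: force2_def u_def)
  have "2 * r * (r\<^sup>2 - 3) * v / u^3 / (2 * (2 * v\<^sup>2 / u^3)) = r * (r\<^sup>2 - 3) / (2 * v)"
    using u v by (simp add: field_simps power2_eq_square)
  then have "pair_force (3 * t) = - (2 * r * (r\<^sup>2 - 3) * v / u^3) + r * (r\<^sup>2 - 3) / (2 * v)"
    unfolding pair_force_def trig by simp
  also have "\<dots> = r * (r\<^sup>2 - 3) * (u^3 - 4 * v\<^sup>2) / (2 * v * u^3)"
    using u v by (simp add: field_simps power2_eq_square)
  also have "u^3 - 4 * v\<^sup>2 = r^6 - 33 * r^4 + 27 * r\<^sup>2 - 3"
    by (simp add: u_def v_def algebra_simps power_numeral_reduce)
  finally show "pair_force (3 * t) = force3 r"
    by (simp add: force3_def u_def v_def)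
qed

text \<open>
  Where the polynomial \<open>g\<close> comes from: it is the factor of the Pfaffian that has real roots other than those of
  the square.
\<close>

lemma force_pfaffian:
  assumes "r \<noteq> 0" "3 * r\<^sup>2 \<noteq> 1"
  shows "(force1 r)\<^sup>2 - (force2 r)\<^sup>2 + force1 r * force3 r =
    (r\<^sup>2 - 1) * (r\<^sup>2 + 1) * poly g r / (16 * r\<^sup>2 * (1 + r\<^sup>2)^4 * (3 * r\<^sup>2 - 1))"
proof -
  define x where "x = r\<^sup>2"
  define u where "u = 1 + x"
  define v where "v = 3 * x - 1"
  have nz: "u \<noteq> 0" "v \<noteq> 0" "x \<noteq> 0"
    using one_plus_square_pos[of r] assms by (auto simp: u_def v_def x_def)
  define q where "q = x\<^sup>2 - 14 * x + 1"
  define p where "p = x^3 - 33 * x\<^sup>2 + 27 * x - 3"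
  have q: "q = r^4 - 14 * r\<^sup>2 + 1" and p: "p = r^6 - 33 * r^4 + 27 * r\<^sup>2 - 3"
    by (simp_all add: q_def p_def x_def)
  have f1: "(force1 r)\<^sup>2 = x * (x - 3)\<^sup>2 / (4 * u\<^sup>2)"
    unfolding force1_def x_def[symmetric] u_def[symmetric]
    by (simp add: power_divide power_mult_distrib x_def)
  have f2: "(force2 r)\<^sup>2 = (x - 1)\<^sup>2 * q\<^sup>2 / (16 * x * u^4)"
    unfolding force2_def q[symmetric] by (simp add: x_def u_def power_divide power_mult_distrib flip: power_mult)
  have xr: "x = r * r"
    by (simp add: x_def power2_eq_square)
  have f13: "force1 r * force3 r = x * (x - 3)\<^sup>2 * p / (4 * v * u^4)"
    unfolding force1_def force3_def p[symmetric]
    unfolding x_def[symmetric] u_def[symmetric] v_def[symmetric]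
    using nz xr by (simp add: divide_simps power_numeral_reduce)
  have "(force1 r)\<^sup>2 - (force2 r)\<^sup>2 + force1 r * force3 r =
      (4 * x\<^sup>2 * (x - 3)\<^sup>2 * u\<^sup>2 * v - (x - 1)\<^sup>2 * q\<^sup>2 * v + 4 * x\<^sup>2 * (x - 3)\<^sup>2 * p) / (16 * x * u^4 * v)"
    unfolding f1 f2 f13 using nz by (simp add: divide_simps power_numeral_reduce) algebra
  also have "4 * x\<^sup>2 * (x - 3)\<^sup>2 * u\<^sup>2 * v - (x - 1)\<^sup>2 * q\<^sup>2 * v + 4 * x\<^sup>2 * (x - 3)\<^sup>2 * p =
      (x - 1) * (x + 1) * poly quintic x"
    unfolding u_def v_def p_def q_def poly_quintic by (simp add: algebra_simps power_numeral_reduce)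
  finally show ?thesis
    by (simp add: poly_g_eq x_def u_def v_def)
qed

text \<open>
  In the variable \<open>x = r\<^sup>2\<close>, the values of the quintic at \<open>1/3\<close>, \<open>1\<close> and \<open>3\<close> are nonzero.  The remaining factors
  of the numerators of the second and third force have no positive root in common with it, by an explicit
  polynomial identity in each case.
\<close>

lemma g_root_nonvanishing:
  assumes "poly g r = 0"
  shows "r \<noteq> 0" "3 * r\<^sup>2 \<noteq> 1" "force1 r \<noteq> 0" "force2 r \<noteq> 0" "force3 r \<noteq> 0"
proof -
  define x where "x = r\<^sup>2"
  have G: "poly quintic x = 0"
    using assms by (simp add: poly_g_eq x_def)
  then have "x > 0"
    by (rule quintic_root_pos)
  then show r: "r \<noteq> 0"
    by (auto simp: x_def)
  have ne: "x \<noteq> y" if "poly quintic y \<noteq> 0" for y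
    using G that by auto
  have x3: "x \<noteq> 1/3" and x: "x \<noteq> 1" "x \<noteq> 3"
    by (rule ne, simp add: quintic_def)+
  then show r3: "3 * r\<^sup>2 \<noteq> 1"
    by (simp add: x_def)
  have u: "1 + r\<^sup>2 \<noteq> 0"
    using one_plus_square_pos[of r] by simp
  show "force1 r \<noteq> 0"
    using r x u by (simp add: force1_def x_def)
  have "x\<^sup>2 - 14 * x + 1 \<noteq> 0"
  proof
    assume "x\<^sup>2 - 14 * x + 1 = 0"
    \<comment> \<open>This is the factorization of the Pfaffian with the common factor \<open>x - 1\<close> removed.\<close>
    moreover have "(x + 1) * poly quintic x =
        16 * x\<^sup>2 * (x - 3)\<^sup>2 * (x\<^sup>2 - 6 * x + 1) - (x - 1) * (x\<^sup>2 - 14 * x + 1)\<^sup>2 * (3 * x - 1)"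
      unfolding poly_quintic by (simp add: algebra_simps power_numeral_reduce)
    ultimately have "x\<^sup>2 - 6 * x + 1 = 0"
      using G x \<open>x > 0\<close> by simp
    with \<open>x\<^sup>2 - 14 * x + 1 = 0\<close> \<open>x > 0\<close> show False
      by simp
  qed
  then show "force2 r \<noteq> 0"
    using r x u by (simp add: force2_def x_def)
  have "x^3 - 33 * x\<^sup>2 + 27 * x - 3 \<noteq> 0"
  proof
    assume p: "x^3 - 33 * x\<^sup>2 + 27 * x - 3 = 0"
    have "272 * (3 * x - 1) * (1 + x)\<^sup>2 +
        (x^3 - 33 * x\<^sup>2 + 27 * x - 3) * (-753 + 16124 * x - 11428 * x\<^sup>2 + 10036 * x^3 - 1131 * x^4) =
        (-1987 + 2860 * x - 87 * x\<^sup>2) * poly quintic x"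
      unfolding poly_quintic by (simp add: algebra_simps power_numeral_reduce)
    then show False
      using G p x3 \<open>x > 0\<close> by simp
  qed
  then show "force3 r \<noteq> 0"
    using r r3 x u by (simp add: force3_def x_def)
qed

text \<open>
  Modulo \<open>g\<close>, the polynomial \<open>a\<close> is the rational function \<open>- force1 / force3\<close>, and \<open>b\<close> below is \<open>- force2 / force3\<close>.  The
  cofactors of the quintic in the two proofs are the quotients of polynomial division of the
  cross-multiplied difference by the quintic.
\<close>

lemma a_eq_force_ratio:
  assumes "poly g r = 0"
  shows "a r = - force1 r / force3 r"
proof -
  define x where "x = r\<^sup>2"
  have G: "poly quintic x = 0"
    using assms by (simp add: poly_g_eq x_def)
  define p where "p = x^3 - 33 * x\<^sup>2 + 27 * x - 3"
  have p: "p = r^6 - 33 * r^4 + 27 * r\<^sup>2 - 3"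
    by (simp add: p_def x_def)
  have a: "272 * a r = -753 + 16124 * x - 11428 * x\<^sup>2 + 10036 * x^3 - 1131 * x^4"
    by (simp add: a_def x_def)
  have "272 * (3 * x - 1) * (1 + x)\<^sup>2 + p * (272 * a r) = (-1987 + 2860 * x - 87 * x\<^sup>2) * poly quintic x"
    unfolding poly_quintic p_def a by (simp add: algebra_simps power_numeral_reduce)
  then have key: "a r * p = - ((3 * x - 1) * (1 + x)\<^sup>2)"
    using G by algebra
  have nz: "3 * x - 1 \<noteq> 0" "1 + x \<noteq> 0"
    using g_root_nonvanishing[OF assms] one_plus_square_pos[of r] by (simp_all add: x_def)
  have "a r * force3 r = a r * p * (r * (x - 3) / (2 * (3 * x - 1) * (1 + x)^3))"
    by (simp add: force3_def p x_def)
  also have "\<dots> = - force1 r"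
    unfolding key force1_def x_def[symmetric] using nz
    by (simp add: divide_simps power_numeral_reduce) algebra
  finally show ?thesis
    using g_root_nonvanishing(5)[OF assms] by (simp add: field_simps)
qed

lemma b_eq_force_ratio:
  assumes "poly g r = 0"
  shows "b r = - force2 r / force3 r"
proof -
  define x where "x = r\<^sup>2"
  have G: "poly quintic x = 0"
    using assms by (simp add: poly_g_eq x_def)
  define p where "p = x^3 - 33 * x\<^sup>2 + 27 * x - 3"
  have p: "p = r^6 - 33 * r^4 + 27 * r\<^sup>2 - 3"
    by (simp add: p_def x_def)
  have b: "4352 * b r = 2827 - 168410 * x + 119616 * x\<^sup>2 - 107718 * x^3 + 12181 * x^4"
    by (simp add: b_def x_def)
  have "2176 * ((x - 1) * (x\<^sup>2 - 14 * x + 1) * (3 * x - 1) * (1 + x)) + x * (x - 3) * p * (4352 * b r) =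
      (937 * x^4 - 33585 * x^3 + 112771 * x\<^sup>2 - 60259 * x - 2176) * poly quintic x"
    unfolding poly_quintic p_def b by (simp add: algebra_simps power_numeral_reduce)
  then have "2 * (b r * (x * (x - 3) * p)) = - ((x - 1) * (x\<^sup>2 - 14 * x + 1) * (3 * x - 1) * (1 + x))"
    using G by algebra
  then have key: "b r * (x * (x - 3) * p) = - ((x - 1) * (x\<^sup>2 - 14 * x + 1) * (3 * x - 1) * (1 + x) / 2)"
    by linarith
  have nz: "r \<noteq> 0" "3 * x - 1 \<noteq> 0" "1 + x \<noteq> 0"
    using g_root_nonvanishing[OF assms] one_plus_square_pos[of r] by (simp_all add: x_def)
  have r: "r = x / r"
    using nz by (simp add: x_def power2_eq_square)
  have "force3 r = r * ((x - 3) * p / (2 * (3 * x - 1) * (1 + x)^3))"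
    by (simp add: force3_def p x_def)
  also have "\<dots> = x / r * ((x - 3) * p / (2 * (3 * x - 1) * (1 + x)^3))"
    using r by simp
  finally have "b r * force3 r = b r * (x * (x - 3) * p) / (2 * r * (3 * x - 1) * (1 + x)^3)"
    by (simp add: mult_ac)
  also have "\<dots> = - ((x - 1) * (x\<^sup>2 - 14 * x + 1) / (4 * r * (1 + x)\<^sup>2))"
    unfolding key using nz by (simp add: divide_simps power_numeral_reduce)
  also have "\<dots> = - force2 r"
    by (simp add: force2_def x_def)
  finally show ?thesis
    using g_root_nonvanishing(5)[OF assms] by (simp add: field_simps)
qed

section \<open>The antisymmetric linear system\<close>

text \<open>
  The Pfaffian times the unit matrix is a matrix product with the system as one factor; this is the first row
  of that identity.
\<close>

lemma antisymmetric_system_pfaffian: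
  fixes A B C m1 m2 m3 m4 :: real
  assumes "A * m1 - A * m3 - B * m4 = 0" "B * m1 + A * m2 - A * m4 = 0" "C * m1 + B * m2 + A * m3 = 0"
  shows "(A\<^sup>2 - B\<^sup>2 + A * C) * m1 = 0"
proof -
  have "(A\<^sup>2 - B\<^sup>2 + A * C) * m1 = A * (A * m1 - A * m3 - B * m4)
      - B * (B * m1 + A * m2 - A * m4) + A * (C * m1 + B * m2 + A * m3)"
    by (simp add: algebra_simps power2_eq_square)
  then show ?thesis
    by (simp add: assms)
qed

text \<open>
  With vanishing Pfaffian the matrix has rank two, so the two equations that contain \<open>C\<close> imply the others.
\<close>

lemma antisymmetric_system_solution:
  fixes A B C m1 m2 m3 m4 :: real
  assumes "A\<^sup>2 - B\<^sup>2 + A * C = 0" "C \<noteq> 0"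
  shows "A * m2 + B * m3 + C * m4 = 0 \<and> A * m1 - A * m3 - B * m4 = 0 \<and>
      B * m1 + A * m2 - A * m4 = 0 \<and> C * m1 + B * m2 + A * m3 = 0 \<longleftrightarrow>
    m1 = (- B / C) * m2 + (- A / C) * m3 \<and> m4 = (- A / C) * m2 + (- B / C) * m3" (is "?eqs \<longleftrightarrow> ?sol")
proof -
  have "?sol \<longleftrightarrow> A * m2 + B * m3 + C * m4 = 0 \<and> C * m1 + B * m2 + A * m3 = 0"
    using assms(2) by (auto simp: field_simps)
  moreover have "A * m1 - A * m3 - B * m4 = 0" "B * m1 + A * m2 - A * m4 = 0"
    if "A * m2 + B * m3 + C * m4 = 0" "C * m1 + B * m2 + A * m3 = 0"
  proof -
    have "C * (A * m1 - A * m3 - B * m4) = 0" "C * (B * m1 + A * m2 - A * m4) = 0"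
      using that assms(1) by algebra+
    then show "A * m1 - A * m3 - B * m4 = 0" "B * m1 + A * m2 - A * m4 = 0"
      using assms(2) by simp_all
  qed
  ultimately show ?thesis
    by blast
qed

section \<open>Equispaced configurations\<close>

definition equispaced_angles :: "real \<Rightarrow> real^4" where
  "equispaced_angles t = vector [0, t, 2 * t, 3 * t]"

text \<open>The angle \<open>\<theta> $ 2\<close> determines an equispaced \<open>\<theta>\<close>, which removes the existential quantifier from \<open>params_at\<close>.\<close>

lemma equispaced_iff:
  "equispaced \<theta> \<and> \<theta> $ 2 = t \<longleftrightarrow>
    \<theta> = equispaced_angles t \<and> t \<in> {-pi<..<pi} - {2 * pi / 3, - (2 * pi / 3)}"
proof -
  have "\<theta> = equispaced_angles t \<longleftrightarrow>
      \<theta> $ 1 = 0 \<and> \<theta> $ 2 = t \<and> \<theta> $ 3 = 2 * t \<and> \<theta> $ 4 = 3 * t"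
    by (simp add: equispaced_angles_def vec_eq_iff forall_4)
  also have "\<dots> \<longleftrightarrow> \<theta> $ 1 = 0 \<and> \<theta> $ 2 - \<theta> $ 1 = \<theta> $ 3 - \<theta> $ 2 \<and>
      \<theta> $ 3 - \<theta> $ 2 = \<theta> $ 4 - \<theta> $ 3 \<and> \<theta> $ 2 = t"
    by (intro iffI conjI; elim conjE; linarith)
  finally have "\<theta> = equispaced_angles t \<longleftrightarrow> \<theta> $ 1 = 0 \<and> \<theta> $ 2 - \<theta> $ 1 = \<theta> $ 3 - \<theta> $ 2 \<and>
      \<theta> $ 3 - \<theta> $ 2 = \<theta> $ 4 - \<theta> $ 3 \<and> \<theta> $ 2 = t" .
  moreover have "\<theta> $ 2 \<in> S \<and> \<theta> $ 2 = t \<longleftrightarrow> t \<in> S \<and> \<theta> $ 2 = t" for S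
    by auto
  ultimately show ?thesis
    unfolding equispaced_def by blast
qed

lemma equispaced_angles_no_collision_iff:
  "(\<forall>i j. i \<noteq> j \<longrightarrow> cos (equispaced_angles t $ i - equispaced_angles t $ j) \<noteq> 1) \<longleftrightarrow>
    cos t \<noteq> 1 \<and> cos (2 * t) \<noteq> 1 \<and> cos (3 * t) \<noteq> 1"
proof -
  have "cos (t - 2 * t) = cos t" "cos (t - 3 * t) = cos (2 * t)" "cos (2 * t - 3 * t) = cos t"
    using cos_minus[of t] cos_minus[of "2 * t"] by (simp_all add: algebra_simps)
  moreover have "cos (2 * t - t) = cos t" "cos (3 * t - t) = cos (2 * t)" "cos (3 * t - 2 * t) = cos t"
    by simp_all
  ultimately show ?thesis
    by (auto simp: equispaced_angles_def forall_4)
qed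

lemma equispaced_critical_iff:
  "(\<forall>i. (\<Sum>j\<in>UNIV. \<mu> $ j * pair_force (equispaced_angles t $ i - equispaced_angles t $ j)) = 0) \<longleftrightarrow>
    (let A = pair_force t; B = pair_force (2 * t); C = pair_force (3 * t)
     in A * \<mu> $ 2 + B * \<mu> $ 3 + C * \<mu> $ 4 = 0 \<and> A * \<mu> $ 1 - A * \<mu> $ 3 - B * \<mu> $ 4 = 0 \<and>
        B * \<mu> $ 1 + A * \<mu> $ 2 - A * \<mu> $ 4 = 0 \<and> C * \<mu> $ 1 + B * \<mu> $ 2 + A * \<mu> $ 3 = 0)"
proof -
  have "pair_force (t - 2 * t) = - pair_force t" "pair_force (t - 3 * t) = - pair_force (2 * t)"
    "pair_force (2 * t - 3 * t) = - pair_force t"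
    using pair_force_minus[of t] pair_force_minus[of "2 * t"] by (simp_all add: algebra_simps)
  moreover have "pair_force (2 * t - t) = pair_force t" "pair_force (3 * t - t) = pair_force (2 * t)"
    "pair_force (3 * t - 2 * t) = pair_force t"
    by simp_all
  ultimately show ?thesis
    by (auto simp: equispaced_angles_def forall_4 sum_4 Let_def pair_force_minus mult.commute)
qed

lemma params_at_iff:
  "\<mu> \<in> params_at t \<longleftrightarrow>
    nonzero_params \<mu> \<and> nonsquare_params \<mu> \<and> t \<in> {-pi<..<pi} - {2 * pi / 3, - (2 * pi / 3)} \<and>
    cos t \<noteq> 1 \<and> cos (2 * t) \<noteq> 1 \<and> cos (3 * t) \<noteq> 1 \<and>
    (let A = pair_force t; B = pair_force (2 * t); C = pair_force (3 * t)
     in A * \<mu> $ 2 + B * \<mu> $ 3 + C * \<mu> $ 4 = 0 \<and> A * \<mu> $ 1 - A * \<mu> $ 3 - B * \<mu> $ 4 = 0 \<and>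
        B * \<mu> $ 1 + A * \<mu> $ 2 - A * \<mu> $ 4 = 0 \<and> C * \<mu> $ 1 + B * \<mu> $ 2 + A * \<mu> $ 3 = 0)"
proof -
  have "\<mu> \<in> params_at t \<longleftrightarrow> nonzero_params \<mu> \<and> nonsquare_params \<mu> \<and>
      (\<exists>\<theta>. (equispaced \<theta> \<and> \<theta> $ 2 = t) \<and> configuration \<mu> \<theta>)"
    by (simp add: params_at_def)
  also have "\<dots> \<longleftrightarrow> nonzero_params \<mu> \<and> nonsquare_params \<mu> \<and>
      t \<in> {-pi<..<pi} - {2 * pi / 3, - (2 * pi / 3)} \<and> configuration \<mu> (equispaced_angles t)"
    unfolding equispaced_iff by blast
  finally show ?thesis
    by (auto simp only: configuration_iff equispaced_angles_no_collision_iff equispaced_critical_iff)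
qed

lemma param_family_iff:
  "\<mu> \<in> param_family r \<longleftrightarrow>
    \<mu> $ 1 = b r * \<mu> $ 2 + a r * \<mu> $ 3 \<and> \<mu> $ 4 = a r * \<mu> $ 2 + b r * \<mu> $ 3"
proof
  assume *: "\<mu> $ 1 = b r * \<mu> $ 2 + a r * \<mu> $ 3 \<and> \<mu> $ 4 = a r * \<mu> $ 2 + b r * \<mu> $ 3"
  have "\<mu> = vector [b r * \<mu> $ 2 + a r * \<mu> $ 3, \<mu> $ 2, \<mu> $ 3, a r * \<mu> $ 2 + b r * \<mu> $ 3]"
    using * by (simp add: vec_eq_iff forall_4)
  then show "\<mu> \<in> param_family r"
    unfolding param_family_def by blast
qed (auto simp: param_family_def)

text \<open>
  By the second and third equations, \<open>A (\<mu>1 - \<mu>3) = B \<mu>4\<close> and \<open>A (\<mu>4 - \<mu>2) = B \<mu>1\<close>, and the \<open>\<mu>\<close> are nonzero.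
  Hence the inequalities that exclude the square hold automatically on the whole family at a root of \<open>g\<close>.
\<close>

lemma nonsquare_iff:
  fixes A B :: real
  assumes "nonzero_params \<mu>" "A \<noteq> 0 \<or> B \<noteq> 0"
    "A * \<mu> $ 1 - A * \<mu> $ 3 - B * \<mu> $ 4 = 0" "B * \<mu> $ 1 + A * \<mu> $ 2 - A * \<mu> $ 4 = 0"
  shows "nonsquare_params \<mu> \<longleftrightarrow> B \<noteq> 0"
proof
  assume ns: "nonsquare_params \<mu>"
  show "B \<noteq> 0"
  proof
    assume "B = 0"
    with assms ns show False
      by (simp add: nonsquare_params_def)
  qed
next
  assume "B \<noteq> 0"
  with assms show "nonsquare_params \<mu>"
    by (auto simp: nonsquare_params_def nonzero_params_def)
qed

text \<open>The factor \<open>r\<^sup>2 - 1\<close> of the Pfaffian also divides the second force, so it can be cancelled here.\<close>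

lemma pfaffian_eq_0_iff:
  assumes "r \<noteq> 0" "3 * r\<^sup>2 \<noteq> 1" "force2 r \<noteq> 0"
  shows "(force1 r)\<^sup>2 - (force2 r)\<^sup>2 + force1 r * force3 r = 0 \<longleftrightarrow> poly g r = 0"
proof -
  have "r\<^sup>2 \<noteq> 1"
    using assms(3) by (auto simp: force2_def)
  moreover have "1 + r\<^sup>2 \<noteq> 0" "r\<^sup>2 + 1 \<noteq> 0"
    using one_plus_square_pos[of r] by simp_all
  ultimately show ?thesis
    using assms by (simp add: force_pfaffian)
qed

lemma force1_or_force2_nonzero:
  assumes "r \<noteq> 0"
  shows "force1 r \<noteq> 0 \<or> force2 r \<noteq> 0"
proof (cases "r\<^sup>2 = 3")
  case True
  then have "r^4 = 9"
    using power_mult[of r 2 2] by simp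
  with True assms show ?thesis
    by (simp add: force2_def)
next
  case False
  with assms one_plus_square_pos[of r] show ?thesis
    by (simp add: force1_def)
qed

text \<open>At the excluded angles \<open>\<plusminus> 2 pi / 3\<close> the first and the fourth vortex collide.\<close>

lemma cos_eq_1_at_thirds: "t \<in> {2 * pi / 3, - (2 * pi / 3)} \<Longrightarrow> cos (3 * t) = 1"
proof -
  assume "t \<in> {2 * pi / 3, - (2 * pi / 3)}"
  then have "3 * t = 2 * pi \<or> 3 * t = - (2 * pi)"
    by auto
  then show ?thesis
    by (metis cos_minus cos_two_pi)
qed

text \<open>
  The core of the argument: existence of a nonsquare solution forces the Pfaffian, hence \<open>g\<close>, to vanish, and
  at a root of \<open>g\<close> the solution plane is the parameter family.
\<close>

lemma params_at_angle_of:
  assumes t: "angle_of r t"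
  shows "params_at t = (if poly g r = 0 then {\<mu> \<in> param_family r. nonzero_params \<mu>} else {})"
proof (cases "poly g r = 0")
  case True
  note nz = g_root_nonvanishing[OF True]
  note forces = pair_force_angle_of[OF t nz(1,2)]
  have pf: "(force1 r)\<^sup>2 - (force2 r)\<^sup>2 + force1 r * force3 r = 0"
    using pfaffian_eq_0_iff[OF nz(1,2,4)] True by blast
  have noncoll: "cos t \<noteq> 1" "cos (2 * t) \<noteq> 1" "cos (3 * t) \<noteq> 1"
    using no_collision_iff[OF t] nz by blast+
  then have "t \<in> {-pi<..<pi} - {2 * pi / 3, - (2 * pi / 3)}"
    using t cos_eq_1_at_thirds by (auto simp: angle_of_def)
  then have "\<mu> \<in> params_at t \<longleftrightarrow> \<mu> \<in> param_family r \<and> nonzero_params \<mu>" for \<mu>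
    unfolding params_at_iff forces Let_def
      param_family_iff a_eq_force_ratio[OF True] b_eq_force_ratio[OF True]
      antisymmetric_system_solution[OF pf nz(5), symmetric]
    using noncoll nonsquare_iff[of \<mu> "force1 r" "force2 r"] nz(4) by blast
  with True show ?thesis
    by auto
next
  case False
  have "\<mu> \<notin> params_at t" for \<mu>
  proof
    assume \<mu>: "\<mu> \<in> params_at t"
    then have nz: "r \<noteq> 0" "3 * r\<^sup>2 \<noteq> 1"
      using no_collision_iff[OF t] unfolding params_at_iff by blast+
    note forces = pair_force_angle_of[OF t nz]
    have nzp: "nonzero_params \<mu>" and ns: "nonsquare_params \<mu>"
      and eqs: "force1 r * \<mu> $ 2 + force2 r * \<mu> $ 3 + force3 r * \<mu> $ 4 = 0"
        "force1 r * \<mu> $ 1 - force1 r * \<mu> $ 3 - force2 r * \<mu> $ 4 = 0"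
        "force2 r * \<mu> $ 1 + force1 r * \<mu> $ 2 - force1 r * \<mu> $ 4 = 0"
        "force3 r * \<mu> $ 1 + force2 r * \<mu> $ 2 + force1 r * \<mu> $ 3 = 0"
      using \<mu> unfolding params_at_iff forces Let_def by blast+
    have "(force1 r)\<^sup>2 - (force2 r)\<^sup>2 + force1 r * force3 r = 0"
      using antisymmetric_system_pfaffian[OF eqs(2-4)] nzp by (simp add: nonzero_params_def)
    moreover have "force2 r \<noteq> 0"
      using nonsquare_iff[OF nzp force1_or_force2_nonzero[OF nz(1)] eqs(2,3)] ns by blast
    ultimately show False
      using pfaffian_eq_0_iff[OF nz] False by blast
  qed
  with False show ?thesis
    by auto
qed

lemma sin_double_arctan: "sin (2 * arctan v) = 2 * v / (1 + v\<^sup>2)"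
proof -
  have "sqrt (1 + v\<^sup>2) * sqrt (1 + v\<^sup>2) = 1 + v\<^sup>2"
    using one_plus_square_pos[of v] by simp
  then show ?thesis
    by (simp only: sin_double sin_arctan cos_arctan times_divide_eq_right times_divide_eq_left mult_1_right
        divide_divide_eq_left)
qed

lemma cos_double_arctan: "cos (2 * arctan v) = 2 / (1 + v\<^sup>2) - 1"
  using one_plus_square_pos[of v] by (simp add: cos_double_cos cos_arctan power_divide)

text \<open>Here \<open>1 / r = tan (t / 2)\<close>.\<close>

lemma angle_of_iff:
  assumes "r \<noteq> 0"
  shows "angle_of r t \<longleftrightarrow> t = 2 * arctan (1 / r)"
proof
  assume t: "angle_of r t"
  have "tan (t / 2) = sin t / (cos t + 1)"
    by (simp add: tan_half)
  also have "cos t + 1 = 2 * r\<^sup>2 / (1 + r\<^sup>2)"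
    using t one_plus_square_pos[of r] by (simp add: angle_of_def field_simps)
  also have "sin t / (2 * r\<^sup>2 / (1 + r\<^sup>2)) = 1 / r"
    using t assms one_plus_square_pos[of r] by (simp add: angle_of_def power2_eq_square)
  finally have "arctan (1 / r) = t / 2"
    using t by (intro arctan_unique) (auto simp: angle_of_def)
  then show "t = 2 * arctan (1 / r)"
    by simp
next
  assume t: "t = 2 * arctan (1 / r)"
  have u: "1 + (1 / r)\<^sup>2 = (1 + r\<^sup>2) / r\<^sup>2"
    using assms by (simp add: field_simps)
  have "sin t = 2 * (1 / r) / (1 + (1 / r)\<^sup>2)" "cos t = 2 / (1 + (1 / r)\<^sup>2) - 1"
    unfolding t by (rule sin_double_arctan cos_double_arctan)+
  then have "sin t = 2 * r / (1 + r\<^sup>2)" "cos t = (r\<^sup>2 - 1) / (1 + r\<^sup>2)"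
    unfolding u using assms one_plus_square_pos[of r]
    by (simp_all add: divide_simps power2_eq_square)
  moreover have "t \<in> {-pi<..<pi}"
    using arctan_bounded[of "1 / r"] by (simp add: t)
  ultimately show "angle_of r t"
    by (simp add: angle_of_def)
qed

text \<open>Conversely, \<open>sin t / (1 - cos t) = cot (t / 2)\<close>.\<close>

lemma angle_of_exists:
  assumes "t \<in> {-pi<..<pi}" "cos t \<noteq> 1"
  shows "angle_of (sin t / (1 - cos t)) t"
proof -
  define c where "c = 1 - cos t"
  have c: "c \<noteq> 0" "cos t = 1 - c"
    using assms(2) by (simp_all add: c_def)
  have "(sin t)\<^sup>2 = c * (2 - c)"
    unfolding sin_squared_eq c by (simp add: power2_eq_square algebra_simps)
  then have "(sin t / c)\<^sup>2 = (2 - c) / c"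
    using c(1) by (simp add: power_divide power2_eq_square)
  then have r2: "(sin t / c)\<^sup>2 = 2 / c - 1"
    using c(1) by (simp add: field_simps)
  have "cos t = (2 / c - 1 - 1) / (1 + (2 / c - 1))"
    unfolding c(2) using c(1) by (simp add: field_simps)
  moreover have "sin t = 2 * (sin t / c) / (1 + (2 / c - 1))"
    using c(1) by simp
  ultimately show ?thesis
    unfolding angle_of_def c_def[symmetric] r2 using assms(1) by blast
qed

lemma angle_of_inj:
  assumes "angle_of r t" "angle_of s t"
  shows "r = s"
proof -
  have "x = sin t / (1 - cos t)" if "angle_of x t" for x
    unfolding angle_of_multiple_angles(1,2)[OF that] using one_plus_square_pos[of x] by simp
  then show ?thesis
    using assms by metis
qed

text \<open>
  The member with \<open>\<mu>2 = \<mu>3 = 1\<close> has \<open>\<mu>1 = \<mu>4 = a + b\<close>.  This is nonzero because the Pfaffian equation reads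
  \<open>A\<^sup>2 - B\<^sup>2 = - A C \<noteq> 0\<close>, so \<open>A + B \<noteq> 0\<close>.
\<close>

lemma param_family_nonzero_exists:
  assumes "poly g r = 0"
  shows "{\<mu> \<in> param_family r. nonzero_params \<mu>} \<noteq> {}"
proof -
  note nz = g_root_nonvanishing[OF assms]
  have "(force1 r)\<^sup>2 - (force2 r)\<^sup>2 = - (force1 r * force3 r)"
    using pfaffian_eq_0_iff[OF nz(1,2,4)] assms by simp
  also have "\<dots> \<noteq> 0"
    using nz by simp
  finally have "force1 r + force2 r \<noteq> 0"
    by (auto simp: add_eq_0_iff2)
  then have "a r + b r \<noteq> 0"
    using nz(5) by (simp add: a_eq_force_ratio[OF assms] b_eq_force_ratio[OF assms] field_simps add_eq_0_iff2)
  then have "vector [a r + b r, 1, 1, a r + b r] \<in> {\<mu> \<in> param_family r. nonzero_params \<mu>}"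
    by (simp add: param_family_iff nonzero_params_def forall_4)
  then show ?thesis
    by blast
qed

theorem theorem9:
  shows "card {r. poly g r = 0} = 6 \<and> card possible_angles = 6 \<and>
    (\<exists>\<phi>. bij_betw \<phi> {r. poly g r = 0} possible_angles \<and>
       (\<forall>r. poly g r = 0 \<longrightarrow>
          (\<forall>t. angle_of r t \<longleftrightarrow> t = \<phi> r) \<and>
          params_at (\<phi> r) = {\<mu> \<in> param_family r. nonzero_params \<mu>}))"
proof -
  define \<phi> where "\<phi> r = 2 * arctan (1 / r)" for r :: real
  have \<phi>: "angle_of r t \<longleftrightarrow> t = \<phi> r" if "poly g r = 0" for r t
    unfolding \<phi>_def using g_root_nonvanishing(1)[OF that] by (rule angle_of_iff)
  have params: "params_at (\<phi> r) = {\<mu> \<in> param_family r. nonzero_params \<mu>}" if "poly g r = 0" for r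
    using params_at_angle_of[of r "\<phi> r"] \<phi>[OF that, of "\<phi> r"] that by simp
  have "inj_on \<phi> {r. poly g r = 0}"
  proof (rule inj_onI)
    fix r s assume "r \<in> {r. poly g r = 0}" "s \<in> {r. poly g r = 0}" "\<phi> r = \<phi> s"
    then have "angle_of r (\<phi> s)" "angle_of s (\<phi> s)"
      using \<phi> by auto
    then show "r = s"
      by (rule angle_of_inj)
  qed
  moreover have "\<phi> ` {r. poly g r = 0} = possible_angles"
  proof (intro equalityI subsetI)
    fix t assume "t \<in> \<phi> ` {r. poly g r = 0}"
    then obtain r where "poly g r = 0" "t = \<phi> r"
      by blast
    then show "t \<in> possible_angles"
      unfolding possible_angles_def using params param_family_nonzero_exists by simp
  next
    fix t assume "t \<in> possible_angles"
    then obtain \<mu> where \<mu>: "\<mu> \<in> params_at t"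
      by (auto simp: possible_angles_def)
    define r where "r = sin t / (1 - cos t)"
    have t: "angle_of r t"
      unfolding r_def using \<mu> by (intro angle_of_exists) (auto simp: params_at_iff)
    with \<mu> have "poly g r = 0"
      using params_at_angle_of[OF t] by (auto split: if_splits)
    with t \<phi> show "t \<in> \<phi> ` {r. poly g r = 0}"
      by blast
  qed
  ultimately have bij: "bij_betw \<phi> {r. poly g r = 0} possible_angles"
    by (simp add: bij_betw_def)
  then have "card possible_angles = 6"
    using bij_betw_same_card card_roots_g by metis
  with bij card_roots_g \<phi> params show ?thesis
    by blast
qed

end
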